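(* Fix an episode $i$, a step $t$ within it, a forecast horizon $n\ge 10$, a safety margin $\epsilon>0$, a quantile level $q\in(0,1)$ and a miscoverage level $\alpha\in(0,1)$. Let $z_i\in\mathbb{R}^m$ be the latent context of episode $i$. Let $(\mu_i,\Sigma_i)$, with $\mu_i\in\mathbb{R}^m$ and $\Sigma_i\in\mathbb{R}^{m\times m}$ positive definite, be the mean and covariance of a Gaussian forecast of $z_i$, let $\rho$ be a conformal radius, and let $$\mathcal{Z}_i(\rho)=\left\{z:\ (z-\mu_i)^\top\Sigma_i^{-1}(z-\mu_i)\le\rho^2\right\}.$$ Let $d_{t+k}$ denote the realized clearance at step $t+k$, let $s_t$ be the state at time $t$, let $\pi$ be the policy, and let $\hat d^{(q)}_{t+k}(z)$ be the predicted $q$-quantile of the clearance at step $t+k$ under context $z$, given by a context-conditioned quantile predictor $\hat d^{(q)}(s,z)$. Assume: (A1) (Conformal context coverage) The radius $\rho$ is chosen such that $$\mathbb{P}\big(z_i\in\mathcal{Z}_i(\rho)\big)\ge 1-\alpha.$$ (A2) (Robust quantile coverage) For each $k\le n$, $$\mathbb{P}\big(d_{t+k}\ge\hat d^{(q)}_{t+k}(z)\,\big|\,s_t,\pi\big)\ge 1-q\qquad\text{for all } z\in\mathcal{Z}_i(\rho),$$ where the probability is over environment stochasticity and (optionally) model randomness. (A3) (MPC feasibility) At each step, the model-predictive-control (MPC) filter selects an action sequence whose predicted trajectory satisfies the robust constraint condition $$\min_{k\le n}\ \inf_{z\in\mathcal{Z}_i(\rho)}\left(\hat d^{(q)}_{t+k}(z)-\epsilon\right)\ge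 0;$$ if no feasible candidate exists, a conservative fallback action is applied. Suppose the MPC filter enforces the inequality displayed in (A3) at time $t$. Then, with probability at least $$1-\alpha-nq,$$ the realized clearance satisfies $$d_{t+k}\ge\epsilon\qquad\text{for all } k=1,\dots,n.$$
   Context: Setting: a reinforcement learning agent (a vehicle, "ego") interacts with an environment over episodes. Each episode $i$ corresponds to a stationary Markov decision process with latent context $z_i$, which changes only between episodes. Within an episode, at each step $t$ the agent observes the clearance margin $$d_t=\min_{j\in\mathcal{O}_t}\Big(\mathrm{dist}(\mathrm{ego},j)-(d_0+h v_t)\Big),$$ where $\mathcal{O}_t$ is the set of surrounding vehicles, $v_t$ is the ego speed, and $d_0+hv_t$ is a speed-dependent safe distance with constants $d_0,h$. Safety requires $d_t>0$. The algorithm predicts an $n$-step lower-quantile forecast of clearance and enforces the proactive constraints $c'_{t+k}=\hat d^{(q)}_{t+k}-\epsilon$ (required to be nonnegative, robustly over contexts in $\mathcal{Z}_i(\rho)$) for $k=1,\dots,n$. The MPC filter does this by sampling candidate action sequences, rolling them out with an ego dynamics model, and accepting only candidates whose predicted trajectory satisfies the robust condition in (A3). The set $\mathcal{Z}_i(\rho)$ is an ellipsoid of plausible contexts built from the Gaussian context forecast. The guarantee concerns the trajectory induced by the selected MPC-filtered actions. *)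

theory Defs
  imports "HOL-Probability.Probability"
begin

definition positive_definite :: "real^'m^'m \<Rightarrow> bool" where
  "positive_definite A \<longleftrightarrow> transpose A = A \<and> (\<forall>x. x \<noteq> 0 \<longrightarrow> x \<bullet> (A *v x) > 0)"

definition context_ellipsoid :: "real^'m \<Rightarrow> real^'m^'m \<Rightarrow> real \<Rightarrow> (real^'m) set" where
  "context_ellipsoid mu Cov rho =
     {z. (z - mu) \<bullet> (matrix_inv Cov *v (z - mu)) \<le> rho\<^sup>2}"

definition clearance ::
  "real \<Rightarrow> real \<Rightarrow> ('s \<Rightarrow> 'v set) \<Rightarrow> ('s \<Rightarrow> 'v \<Rightarrow> real) \<Rightarrow> ('s \<Rightarrow> real) \<Rightarrow> 's \<Rightarrow> real" where
  "clearance d0 h obs ego_dist speed s =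
     Min ((\<lambda>j. ego_dist s j - (d0 + h * speed s)) ` obs s)"


text \<open>
  Conditional laws are expressed through the library's conditional expectation. A sigma-algebra
  generated by a random element \<open>Y\<close> with values in \<open>N\<close> is \<open>vimage_algebra (space M) Y N\<close>.
\<close>

definition cond_prob_given ::
  "'w measure \<Rightarrow> ('w \<Rightarrow> 'b) \<Rightarrow> 'b measure \<Rightarrow> ('w \<Rightarrow> bool) \<Rightarrow> 'w \<Rightarrow> real" where
  "cond_prob_given M Y N P =
     real_cond_exp M (vimage_algebra (space M) Y N) (indicator {\<omega> \<in> space M. P \<omega>})"

definition has_cond_law ::
  "'w measure \<Rightarrow> ('w \<Rightarrow> 'b) \<Rightarrow> 'b measure \<Rightarrow> ('w \<Rightarrow> 'x) \<Rightarrow> 'x measure \<Rightarrow> ('w \<Rightarrow> 'x measure) \<Rightarrow> bool"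
where
  "has_cond_law M Y N X NX K \<longleftrightarrow>
     (\<forall>B\<in>sets NX. AE \<omega> in M. cond_prob_given M Y N (\<lambda>\<omega>'. X \<omega>' \<in> B) \<omega> = measure (K \<omega>) B)"


text \<open>
  What the agent has seen when it acts at step \<open>i\<close>: states up to \<open>i\<close> and actions before \<open>i\<close>.
\<close>

definition history ::
  "(nat \<Rightarrow> 'w \<Rightarrow> 's) \<Rightarrow> (nat \<Rightarrow> 'w \<Rightarrow> 'u) \<Rightarrow> nat \<Rightarrow> 'w \<Rightarrow> (nat \<Rightarrow> 's) \<times> (nat \<Rightarrow> 'u)" where
  "history S A i \<omega> = ((\<lambda>j\<in>{..i}. S j \<omega>), (\<lambda>j\<in>{..<i}. A j \<omega>))"

definition history_space ::
  "'s measure \<Rightarrow> 'u measure \<Rightarrow> nat \<Rightarrow> ((nat \<Rightarrow> 's) \<times> (nat \<Rightarrow> 'u)) measure" where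
  "history_space MSt MAct i = PiM {..i} (\<lambda>_. MSt) \<Otimes>\<^sub>M PiM {..<i} (\<lambda>_. MAct)"

text \<open>
  \<open>M\<close> is the law, under policy \<open>pol\<close>, of an episode of a stationary Markov decision process whose
  transition kernel \<open>T\<close> depends on a latent context \<open>z\<close>. The context is drawn once and stays fixed
  during the episode. The policy may randomise and may use the whole observed history, but it
  does not see \<open>z\<close>.
\<close>

definition contextual_mdp_episode ::
  "'w measure \<Rightarrow> 's measure \<Rightarrow> 'u measure
   \<Rightarrow> (real^'m \<Rightarrow> 's \<Rightarrow> 'u \<Rightarrow> 's measure)
   \<Rightarrow> (nat \<Rightarrow> (nat \<Rightarrow> 's) \<times> (nat \<Rightarrow> 'u) \<Rightarrow> 'u measure)
   \<Rightarrow> ('w \<Rightarrow> real^'m) \<Rightarrow> (nat \<Rightarrow> 'w \<Rightarrow> 's) \<Rightarrow> (nat \<Rightarrow> 'w \<Rightarrow> 'u) \<Rightarrow> bool" where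
  "contextual_mdp_episode M MSt MAct T pol z S A \<longleftrightarrow>
     prob_space M \<and>
     z \<in> borel_measurable M \<and>
     (\<forall>i. S i \<in> measurable M MSt) \<and>
     (\<forall>i. A i \<in> measurable M MAct) \<and>
     (\<lambda>(c, s, a). T c s a) \<in> measurable (borel \<Otimes>\<^sub>M MSt \<Otimes>\<^sub>M MAct) (prob_algebra MSt) \<and>
     (\<forall>i. pol i \<in> measurable (history_space MSt MAct i) (prob_algebra MAct)) \<and>
     (\<forall>i. has_cond_law M
            (\<lambda>\<omega>. (z \<omega>, history S A i \<omega>)) (borel \<Otimes>\<^sub>M history_space MSt MAct i)
            (A i) MAct (\<lambda>\<omega>. pol i (history S A i \<omega>))) \<and>
     (\<forall>i. has_cond_law M
            (\<lambda>\<omega>. (z \<omega>, history S A i \<omega>, A i \<omega>)) (borel \<Otimes>\<^sub>M history_space MSt MAct i \<Otimes>\<^sub>M MAct)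
            (S (Suc i)) MSt (\<lambda>\<omega>. T (z \<omega>) (S i \<omega>) (A i \<omega>)))"


text \<open>
  Candidate action sequences are functions on \<open>nat\<close>; an \<open>n\<close>-step prediction only reads the
  entries below \<open>n\<close>. The argument \<open>e\<close> is a realisation of the optional model randomness; a
  deterministic model simply ignores it.
\<close>

primrec rollout :: "('e \<Rightarrow> 's \<Rightarrow> 'u \<Rightarrow> 's) \<Rightarrow> 'e \<Rightarrow> 's \<Rightarrow> (nat \<Rightarrow> 'u) \<Rightarrow> nat \<Rightarrow> 's" where
  "rollout ego e s a 0 = s"
| "rollout ego e s a (Suc k) = ego e (rollout ego e s a k) (a k)"

definition quantile_forecast ::
  "('e \<Rightarrow> 's \<Rightarrow> 'u \<Rightarrow> 's) \<Rightarrow> (real \<Rightarrow> 'e \<Rightarrow> 's \<Rightarrow> 'c \<Rightarrow> real) \<Rightarrow> real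
   \<Rightarrow> 'e \<Rightarrow> 's \<Rightarrow> (nat \<Rightarrow> 'u) \<Rightarrow> nat \<Rightarrow> 'c \<Rightarrow> real" where
  "quantile_forecast ego dhat q e s a k c = dhat q e (rollout ego e s a k) c"

text \<open>
  The infimum is taken in \<open>ereal\<close>, because a real-valued \<open>Inf\<close> carries no information when the
  forecast is unbounded below on \<open>Z\<close>.
\<close>

definition robust_constraint :: "nat \<Rightarrow> real \<Rightarrow> 'c set \<Rightarrow> (nat \<Rightarrow> 'c \<Rightarrow> real) \<Rightarrow> bool" where
  "robust_constraint n eps Z f \<longleftrightarrow>
     Min ((\<lambda>k. INF c\<in>Z. ereal (f k c - eps)) ` {1..n}) \<ge> 0"

text \<open>
  One receding-horizon step: from the sampled candidates \<open>C\<close> a feasible sequence \<open>plan\<close> is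
  selected and its first action is applied; without a feasible candidate the fallback
  action \<open>fb\<close> is applied.
\<close>

definition mpc_filter_step ::
  "((nat \<Rightarrow> 'u) \<Rightarrow> bool) \<Rightarrow> (nat \<Rightarrow> 'u) set \<Rightarrow> (nat \<Rightarrow> 'u) \<Rightarrow> 'u \<Rightarrow> 'u \<Rightarrow> bool" where
  "mpc_filter_step feasible C plan fb act \<longleftrightarrow>
     (if \<exists>a\<in>C. feasible a then plan \<in> C \<and> feasible plan \<and> act = plan 0 else act = fb)"

end

theory Submission
  imports Defs
begin

text \<open>
  The center \<open>mu\<close> always lies in the ellipsoid. At this single context the robust constraint forces
  every forecast to be at least \<open>eps\<close>, so a violation at step \<open>k\<close> implies that the realized clearance
  falls below the forecast at \<open>mu\<close>. By (A2) and the tower property this has probability at most \<open>q\<close>,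
  and a union bound over the \<open>n\<close> steps gives probability at least \<open>1 - n q\<close>.
\<close>

text \<open>At the center the quadratic form vanishes, and \<open>rho\<^sup>2\<close> is nonnegative
  whatever the sign of \<open>rho\<close>.\<close>

lemma center_in_context_ellipsoid: "mu \<in> context_ellipsoid mu Cov rho"
  by (simp add: context_ellipsoid_def)

lemma robust_constraintD:
  assumes "robust_constraint n eps Z f" "k \<in> {1..n}" "c \<in> Z"
  shows "eps \<le> f k c"
proof -
  \<comment> \<open>Membership of \<open>k\<close> makes \<open>{1..n}\<close> nonempty, so the
    bound on the \<open>Min\<close> passes to each of its entries.\<close>
  have "0 \<le> (INF c\<in>Z. ereal (f k c - eps))"
    using assms(1,2) unfolding robust_constraint_def by (subst (asm) Min_ge_iff) auto
  also have "\<dots> \<le> ereal (f k c - eps)"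
    using assms(3) by (rule INF_lower)
  finally show ?thesis
    by simp
qed

text \<open>A rollout of \<open>k\<close> steps reads finitely many entries of the plan, so
  measurability in each coordinate is enough, by induction on \<open>k\<close>.\<close>

lemma rollout_measurable:
  assumes ego: "(\<lambda>(e, s, a). ego e s a) \<in> measurable (MMod \<Otimes>\<^sub>M MSt \<Otimes>\<^sub>M MAct) MSt"
    and X: "X \<in> measurable M MMod" and Y: "Y \<in> measurable M MSt"
    and U: "\<And>j. (\<lambda>\<omega>. U \<omega> j) \<in> measurable M MAct"
  shows "(\<lambda>\<omega>. rollout ego (X \<omega>) (Y \<omega>) (U \<omega>) k) \<in> measurable M MSt"
proof (induction k)
  case 0
  show ?case using Y by simp
next
  case (Suc k)
  have "(\<lambda>\<omega>. (X \<omega>, rollout ego (X \<omega>) (Y \<omega>) (U \<omega>) k, U \<omega> k))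
      \<in> measurable M (MMod \<Otimes>\<^sub>M MSt \<Otimes>\<^sub>M MAct)"
    using X Suc U by (intro measurable_Pair)
  from measurable_compose[OF this ego] show ?case
    by simp
qed

text \<open>Used to show that the comparison of clearance with forecast is an event. The context
  \<open>c\<close> is frozen, while model noise, state and plan may all be random.\<close>

lemma quantile_forecast_measurable:
  assumes ego: "(\<lambda>(e, s, a). ego e s a) \<in> measurable (MMod \<Otimes>\<^sub>M MSt \<Otimes>\<^sub>M MAct) MSt"
    and dhat: "(\<lambda>(e, s, c). dhat q e s c) \<in> borel_measurable (MMod \<Otimes>\<^sub>M MSt \<Otimes>\<^sub>M borel)"
    and X: "X \<in> measurable M MMod" and Y: "Y \<in> measurable M MSt"
    and U: "\<And>j. (\<lambda>\<omega>. U \<omega> j) \<in> measurable M MAct"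
  shows "(\<lambda>\<omega>. quantile_forecast ego dhat q (X \<omega>) (Y \<omega>) (U \<omega>) k c) \<in> borel_measurable M"
proof -
  have "(\<lambda>\<omega>. (X \<omega>, rollout ego (X \<omega>) (Y \<omega>) (U \<omega>) k, c))
      \<in> measurable M (MMod \<Otimes>\<^sub>M MSt \<Otimes>\<^sub>M borel)"
    using X rollout_measurable[OF ego X Y U] by (intro measurable_Pair) auto
  from measurable_compose[OF this dhat] show ?thesis
    by (simp add: quantile_forecast_def)
qed

text \<open>Tower property: the conditional probability integrates to the unconditional one, so an
  almost sure lower bound on it survives integration.\<close>

lemma (in prob_space) prob_ge_if_cond_prob_ge:
  assumes Y: "Y \<in> measurable M N" and P: "{\<omega> \<in> space M. P \<omega>} \<in> events"
    and ge: "AE \<omega> in M. cond_prob_given M Y N P \<omega> \<ge> p"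
  shows "\<P>(\<omega> in M. P \<omega>) \<ge> p"
proof -
  let ?F = "vimage_algebra (space M) Y N" and ?I = "indicator {\<omega> \<in> space M. P \<omega>} :: 'a \<Rightarrow> real"
  \<comment> \<open>Measurability of \<open>Y\<close> puts the sigma-algebra it generates inside
    that of \<open>M\<close>, which is what conditioning on \<open>Y\<close> requires.\<close>
  have "subalgebra M ?F"
    using measurable_space[OF Y] measurable_sets[OF Y]
    by (auto simp: subalgebra_def sets_vimage_algebra2)
  then interpret finite_measure_subalgebra M ?F
    by unfold_locales
  have I: "integrable M ?I"
    using P by (simp add: integrable_indicator_iff emeasure_eq_measure)
  have "p = (\<integral>\<omega>. p \<partial>M)"
    by (simp add: prob_space)
  also have "\<dots> \<le> (\<integral>\<omega>. cond_prob_given M Y N P \<omega> \<partial>M)"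
    using ge real_cond_exp_int(1)[OF I] unfolding cond_prob_given_def
    by (intro integral_mono_AE) auto
  also have "\<dots> = (\<integral>\<omega>. ?I \<omega> \<partial>M)"
    unfolding cond_prob_given_def by (rule real_cond_exp_int(2)[OF I])
  also have "\<dots> = \<P>(\<omega> in M. P \<omega>)"
    using P by simp
  finally show ?thesis .
qed

text \<open>Union bound over the complements, each of probability at most \<open>q\<close>; the
  events may depend on each other in any way.\<close>

lemma (in prob_space) prob_Ball_ge:
  assumes fin: "finite I" and E: "\<And>k. k \<in> I \<Longrightarrow> {\<omega> \<in> space M. P k \<omega>} \<in> events"
    and ge: "\<And>k. k \<in> I \<Longrightarrow> \<P>(\<omega> in M. P k \<omega>) \<ge> 1 - q"
  shows "\<P>(\<omega> in M. \<forall>k\<in>I. P k \<omega>) \<ge> 1 - real (card I) * q"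
proof -
  let ?B = "\<lambda>k. {\<omega> \<in> space M. \<not> P k \<omega>}"
  have B: "?B k \<in> events" "prob (?B k) \<le> q" if "k \<in> I" for k
    using E[OF that] ge[OF that] prob_neg[of "P k"] by auto
  have "prob (\<Union>k\<in>I. ?B k) \<le> (\<Sum>k\<in>I. prob (?B k))"
    using fin B by (intro finite_measure_subadditive_finite) auto
  also have "\<dots> \<le> real (card I) * q"
    using B by (intro sum_bounded_above) auto
  finally have "prob (\<Union>k\<in>I. ?B k) \<le> real (card I) * q" .
  moreover have "{\<omega> \<in> space M. \<forall>k\<in>I. P k \<omega>} = space M - (\<Union>k\<in>I. ?B k)"
    by auto
  moreover have "(\<Union>k\<in>I. ?B k) \<in> events"
    using fin B by auto
  ultimately show ?thesis
    by (simp add: prob_compl)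
qed

theorem theorem1:
  fixes M :: "'w measure" and MSt :: "'s measure" and MAct :: "'u measure" and MMod :: "'e measure"
    and T :: "real^'m \<Rightarrow> 's \<Rightarrow> 'u \<Rightarrow> 's measure"
    and pol :: "nat \<Rightarrow> (nat \<Rightarrow> 's) \<times> (nat \<Rightarrow> 'u) \<Rightarrow> 'u measure"
    and z :: "'w \<Rightarrow> real^'m"
    and S :: "nat \<Rightarrow> 'w \<Rightarrow> 's" and A :: "nat \<Rightarrow> 'w \<Rightarrow> 'u"
    and obs :: "'s \<Rightarrow> 'v set" and ego_dist :: "'s \<Rightarrow> 'v \<Rightarrow> real" and speed :: "'s \<Rightarrow> real"
    and d0 h :: real
    and d :: "nat \<Rightarrow> 'w \<Rightarrow> real"
    and mu :: "real^'m" and Cov :: "real^'m^'m" and rho :: real and Z :: "(real^'m) set"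
    and ego :: "'e \<Rightarrow> 's \<Rightarrow> 'u \<Rightarrow> 's" and dhat :: "real \<Rightarrow> 'e \<Rightarrow> 's \<Rightarrow> real^'m \<Rightarrow> real"
    and xi :: "nat \<Rightarrow> 'w \<Rightarrow> 'e"
    and cand :: "nat \<Rightarrow> 'w \<Rightarrow> (nat \<Rightarrow> 'u) set" and plan :: "nat \<Rightarrow> 'w \<Rightarrow> nat \<Rightarrow> 'u"
    and fallback :: "'s \<Rightarrow> 'u"
    and forecast :: "nat \<Rightarrow> 'w \<Rightarrow> (nat \<Rightarrow> 'u) \<Rightarrow> nat \<Rightarrow> real^'m \<Rightarrow> real"
    and t n :: nat and eps q alpha :: real
  defines "d \<equiv> \<lambda>i \<omega>. clearance d0 h obs ego_dist speed (S i \<omega>)"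
    and "Z \<equiv> context_ellipsoid mu Cov rho"
    and "forecast \<equiv> \<lambda>i \<omega>. quantile_forecast ego dhat q (xi i \<omega>) (S i \<omega>)"
  assumes n: "n \<ge> 10" and eps: "eps > 0" and q: "0 < q" "q < 1" and alpha: "0 < alpha" "alpha < 1"
    and Cov: "positive_definite Cov"
    and episode: "contextual_mdp_episode M MSt MAct T pol z S A"
    and obs: "\<And>s. s \<in> space MSt \<Longrightarrow> finite (obs s) \<and> obs s \<noteq> {}"
    and clearance_meas: "clearance d0 h obs ego_dist speed \<in> borel_measurable MSt"
    and xi_meas: "\<And>i. xi i \<in> measurable M MMod"
    and plan_meas: "\<And>i j. (\<lambda>\<omega>. plan i \<omega> j) \<in> measurable M MAct"
    and ego_meas: "(\<lambda>(e, s, a). ego e s a) \<in> measurable (MMod \<Otimes>\<^sub>M MSt \<Otimes>\<^sub>M MAct) MSt"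
    and dhat_meas: "(\<lambda>(e, s, c). dhat q e s c) \<in> borel_measurable (MMod \<Otimes>\<^sub>M MSt \<Otimes>\<^sub>M borel)"
    and A1: "\<P>(\<omega> in M. z \<omega> \<in> Z) \<ge> 1 - alpha"
    and A2: "\<And>k c. k \<in> {1..n} \<Longrightarrow> c \<in> Z \<Longrightarrow>
      AE \<omega> in M. cond_prob_given M (S t) MSt
        (\<lambda>\<omega>'. d (t + k) \<omega>' \<ge> forecast t \<omega>' (plan t \<omega>') k c) \<omega> \<ge> 1 - q"
    and A3: "\<And>i. AE \<omega> in M.
      mpc_filter_step (\<lambda>a. robust_constraint n eps Z (forecast i \<omega> a))
        (cand i \<omega>) (plan i \<omega>) (fallback (S i \<omega>)) (A i \<omega>)"
    and enforced: "AE \<omega> in M. robust_constraint n eps Z (forecast t \<omega> (plan t \<omega>))"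
  shows "\<P>(\<omega> in M. \<forall>k\<in>{1..n}. d (t + k) \<omega> \<ge> eps) \<ge> 1 - alpha - real n * q"
proof -
  from episode interpret prob_space M
    by (simp add: contextual_mdp_episode_def)
  have S: "S i \<in> measurable M MSt" for i
    using episode by (simp add: contextual_mdp_episode_def)
  have d_meas: "d i \<in> borel_measurable M" for i
    unfolding d_def by (rule measurable_compose[OF S clearance_meas])
  have f_meas: "(\<lambda>\<omega>. forecast t \<omega> (plan t \<omega>) k mu) \<in> borel_measurable M" for k
    unfolding forecast_def
    by (rule quantile_forecast_measurable[where dhat=dhat and q=q, OF ego_meas dhat_meas xi_meas S])
      (rule plan_meas)
  have mu: "mu \<in> Z"
    unfolding Z_def by (rule center_in_context_ellipsoid)
  have events: "{\<omega> \<in> space M. d (t + k) \<omega> \<ge> eps} \<in> events" for k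
    using d_meas by measurable
  have "\<P>(\<omega> in M. d (t + k) \<omega> \<ge> eps) \<ge> 1 - q" if k: "k \<in> {1..n}" for k
  proof -
    \<comment> \<open>\<open>A2\<close> is taken at the fixed context \<open>mu\<close>, and
      conditioning on \<open>S t\<close> is averaged out.\<close>
    have "1 - q \<le> \<P>(\<omega> in M. d (t + k) \<omega> \<ge> forecast t \<omega> (plan t \<omega>) k mu)"
      using d_meas f_meas by (intro prob_ge_if_cond_prob_ge[OF S _ A2[OF k mu]]) measurable
    also have "\<dots> \<le> \<P>(\<omega> in M. d (t + k) \<omega> \<ge> eps)"
    \<comment> \<open>The inclusion holds only almost surely, because \<open>enforced\<close> does:
      off a null set the forecast at \<open>mu\<close> is at least \<open>eps\<close>.\<close>
    proof (rule finite_measure_mono_AE[OF _ events])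
      show "AE \<omega> in M. \<omega> \<in> {\<omega> \<in> space M. d (t + k) \<omega> \<ge> forecast t \<omega> (plan t \<omega>) k mu} \<longrightarrow>
          \<omega> \<in> {\<omega> \<in> space M. d (t + k) \<omega> \<ge> eps}"
        using enforced by eventually_elim (auto dest: robust_constraintD[OF _ k mu])
    qed
    finally show ?thesis .
  qed
  then have "\<P>(\<omega> in M. \<forall>k\<in>{1..n}. d (t + k) \<omega> \<ge> eps) \<ge> 1 - real (card {1..n}) * q"
    using events by (intro prob_Ball_ge) auto
  \<comment> \<open>The bound \<open>1 - real n * q\<close> just obtained exceeds the claimed one by
    \<open>alpha\<close>, which is positive.\<close>
  then show ?thesis
    using alpha by simp
qed

end
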